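(* Let $B>0$, let $k\in\mathbb{N}=\{1,2,3,\dots\}$, and let $\Omega\subset\mathbb{R}^2$ be a domain of finite measure. There are infinitely many linearly independent functions $U\in C^\infty(\Omega)\cap L_2(\Omega)$, each satisfying $$(\mathbf{D}-B\mathbf{A})^2U=B(2k-1)\,U\qquad\text{in }\Omega$$ and $$\int_\Omega|(\mathbf{D}-B\mathbf{A})U|^2\,dz\le B(2k-1)\int_\Omega|U|^2\,dz .$$
   Context: Points of $\mathbb{R}^2$ are written $z=(x,y)$, and $dz$ is Lebesgue measure. A domain is a non-empty open connected set. Functions are complex-valued. $\mathbf{D}=-i\nabla$ and $\mathbf{A}(x,y)=\frac12(-y,x)^T$. Thus $(\mathbf{D}-B\mathbf{A})U$ is the $\mathbb{C}^2$-valued function $-i\nabla U-B\mathbf{A}U$, and $$(\mathbf{D}-B\mathbf{A})^2=\left(-i\partial_x+\tfrac{B}{2}y\right)^2+\left(-i\partial_y-\tfrac{B}{2}x\right)^2 .$$ *)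

theory Defs
  imports "HOL-Analysis.Analysis" "HOL-Library.Function_Algebras"
begin

definition pdx :: "(real \<times> real \<Rightarrow> complex) \<Rightarrow> real \<times> real \<Rightarrow> complex"
  where "pdx U = (\<lambda>(x, y). vector_derivative (\<lambda>t. U (t, y)) (at x))"

definition pdy :: "(real \<times> real \<Rightarrow> complex) \<Rightarrow> real \<times> real \<Rightarrow> complex"
  where "pdy U = (\<lambda>(x, y). vector_derivative (\<lambda>t. U (x, t)) (at y))"

fun Ck_on :: "nat \<Rightarrow> (real \<times> real) set \<Rightarrow> (real \<times> real \<Rightarrow> complex) \<Rightarrow> bool"
  where
    "Ck_on 0 \<Omega> U \<longleftrightarrow> continuous_on \<Omega> U"
  | "Ck_on (Suc n) \<Omega> U \<longleftrightarrow> continuous_on \<Omega> U \<and>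
       (\<forall>(x, y)\<in>\<Omega>. (\<lambda>t. U (t, y)) differentiable (at x) \<and> (\<lambda>t. U (x, t)) differentiable (at y)) \<and>
       Ck_on n \<Omega> (pdx U) \<and> Ck_on n \<Omega> (pdy U)"

text \<open>
  A function on \<open>\<Omega>\<close> is represented by its extension by zero to the plane, so that equality and
  linear (in)dependence of representatives are equality and linear (in)dependence on \<open>\<Omega>\<close>.
  The extension need not be regular across the boundary: \<open>Ck_on\<close> and the
  differential operators below are only evaluated at points of the open set \<open>\<Omega>\<close>.
\<close>

definition functions_on :: "(real \<times> real) set \<Rightarrow> (real \<times> real \<Rightarrow> complex) set"
  where "functions_on \<Omega> = {U. \<forall>z. z \<notin> \<Omega> \<longrightarrow> U z = 0}"

definition C_infinity :: "(real \<times> real) set \<Rightarrow> (real \<times> real \<Rightarrow> complex) set"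
  where "C_infinity \<Omega> = {U \<in> functions_on \<Omega>. \<forall>n. Ck_on n \<Omega> U}"

definition L2 :: "(real \<times> real) set \<Rightarrow> (real \<times> real \<Rightarrow> complex) set"
  where "L2 \<Omega> = {U \<in> functions_on \<Omega>. set_borel_measurable lebesgue \<Omega> U \<and>
                    set_integrable lebesgue \<Omega> (\<lambda>z. (norm (U z))\<^sup>2)}"

interpretation cfun: vector_space "\<lambda>(c::complex) (U :: real \<times> real \<Rightarrow> complex). (\<lambda>z. c * U z)"
  by unfold_locales (auto simp: fun_eq_iff algebra_simps)

definition vec_pot :: "real \<times> real \<Rightarrow> real \<times> real"
  where "vec_pot = (\<lambda>(x, y). (- y / 2, x / 2))"

text \<open>The two components of \<open>-\<i>\<nabla> - B A\<close>.\<close>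

definition mag_x :: "real \<Rightarrow> (real \<times> real \<Rightarrow> complex) \<Rightarrow> real \<times> real \<Rightarrow> complex"
  where "mag_x B U z = - \<i> * pdx U z - of_real (B * fst (vec_pot z)) * U z"

definition mag_y :: "real \<Rightarrow> (real \<times> real \<Rightarrow> complex) \<Rightarrow> real \<times> real \<Rightarrow> complex"
  where "mag_y B U z = - \<i> * pdy U z - of_real (B * snd (vec_pot z)) * U z"

definition mag_grad :: "real \<Rightarrow> (real \<times> real \<Rightarrow> complex) \<Rightarrow> real \<times> real \<Rightarrow> complex \<times> complex"
  where "mag_grad B U z = (mag_x B U z, mag_y B U z)"

definition mag_op :: "real \<Rightarrow> (real \<times> real \<Rightarrow> complex) \<Rightarrow> real \<times> real \<Rightarrow> complex"
  where "mag_op B U z = mag_x B (mag_x B U) z + mag_y B (mag_y B U) z"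

end

theory Submission
  imports Defs "HOL-Probability.Distributions"
begin

text \<open>Magnetic translations preserve the Landau levels. Let \<open>u\<close> be a square integrable state of level
  \<open>k\<close> on the plane and \<open>u\<^sub>a\<close> its translate by \<open>a\<close>. By Tonelli, the integral over \<open>a\<close> of
  \<open>\<integral>\<^sub>\<Omega> |(D - BA) u\<^sub>a|\<^sup>2 - B (2k - 1) |u\<^sub>a|\<^sup>2\<close> is \<open>|\<Omega>|\<close> times the same expression for \<open>u\<close> on the
  whole plane, hence zero. So the integrand is nonpositive for a non-null, in particular infinite,
  set of \<open>a\<close>, and the corresponding \<open>u\<^sub>a\<close> are linearly independent on \<open>\<Omega>\<close>. We take
  \<open>u z = cnj z ^ (k - 1) * exp (- B |z|\<^sup>2 / 4)\<close>, for which everything is explicit.\<close>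

section \<open>Averaging over translations\<close>

text \<open>The affine map \<open>x \<mapsto> z - x\<close> has Jacobian of modulus 1, so it
  preserves Lebesgue measure.\<close>

lemma nn_integral_lborel_reflect_translate:
  fixes f :: "'a::euclidean_space \<Rightarrow> ennreal"
  assumes [measurable]: "f \<in> borel_measurable borel"
  shows "(\<integral>\<^sup>+a. f (z - a) \<partial>lborel) = (\<integral>\<^sup>+w. f w \<partial>lborel)"
proof -
  have "(\<integral>\<^sup>+w. f w \<partial>lborel)
      = (\<integral>\<^sup>+w. f w \<partial>density (distr lborel borel (\<lambda>x. z + (-1) *\<^sub>R x)) (\<lambda>_. ennreal (\<bar>-1\<bar> ^ DIM('a))))"
    using lborel_affine[of "-1" z] by simp
  also have "\<dots> = (\<integral>\<^sup>+a. f (z - a) \<partial>lborel)"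
    by (simp add: nn_integral_density nn_integral_distr)
  finally show ?thesis by simp
qed

text \<open>Tonelli moves the integral over \<open>a\<close> inside. For fixed \<open>z\<close> it
  is then the full integral of \<open>f\<close>, whatever \<open>z\<close> is, and the remaining
  integral only measures \<open>\<Omega>\<close>.\<close>

lemma nn_integral_average_translates:
  fixes f :: "'a::euclidean_space \<Rightarrow> ennreal"
  assumes [measurable]: "f \<in> borel_measurable borel" "\<Omega> \<in> sets borel"
  shows "(\<integral>\<^sup>+a. (\<integral>\<^sup>+z\<in>\<Omega>. f (z - a) \<partial>lborel) \<partial>lborel) = emeasure lborel \<Omega> * (\<integral>\<^sup>+w. f w \<partial>lborel)"
proof -
  have "(\<integral>\<^sup>+a. (\<integral>\<^sup>+z. f (z - a) * indicator \<Omega> z \<partial>lborel) \<partial>lborel)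
      = (\<integral>\<^sup>+z. (\<integral>\<^sup>+a. f (z - a) * indicator \<Omega> z \<partial>lborel) \<partial>lborel)"
    by (rule lborel_pair.Fubini') simp
  also have "\<dots> = (\<integral>\<^sup>+z. (\<integral>\<^sup>+w. f w \<partial>lborel) * indicator \<Omega> z \<partial>lborel)"
    by (simp add: nn_integral_multc nn_integral_lborel_reflect_translate)
  also have "\<dots> = emeasure lborel \<Omega> * (\<integral>\<^sup>+w. f w \<partial>lborel)"
    using nn_integral_cmult_indicator[of \<Omega> lborel "\<integral>\<^sup>+w. f w \<partial>lborel"]
    by (simp add: mult.commute)
  finally show ?thesis .
qed

text \<open>Both sides have the same finite average over \<open>a\<close>, by
  \<open>nn_integral_average_translates\<close>. If the inequality held for finitely many
  \<open>a\<close> only, its strict reverse would hold almost everywhere and the averages would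
  differ.\<close>

lemma infinite_translates_le:
  fixes f g :: "'a::euclidean_space \<Rightarrow> ennreal"
  assumes [measurable]: "f \<in> borel_measurable borel" "g \<in> borel_measurable borel" "\<Omega> \<in> sets borel"
    and eq: "(\<integral>\<^sup>+w. f w \<partial>lborel) = (\<integral>\<^sup>+w. g w \<partial>lborel)"
    and fin: "(\<integral>\<^sup>+w. g w \<partial>lborel) < \<infinity>" "emeasure lborel \<Omega> < \<infinity>"
  shows "infinite {a. (\<integral>\<^sup>+z\<in>\<Omega>. f (z - a) \<partial>lborel) \<le> (\<integral>\<^sup>+z\<in>\<Omega>. g (z - a) \<partial>lborel)}"
    (is "infinite {a. ?F a \<le> ?G a}")
proof
  assume "finite {a. ?F a \<le> ?G a}"
  then have ae: "AE a in lborel. \<not> ?F a \<le> ?G a"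
    by (intro AE_I'[of "{a. ?F a \<le> ?G a}"] finite_imp_null_set_lborel) auto
  have "(\<integral>\<^sup>+a. ?G a \<partial>lborel) < (\<integral>\<^sup>+a. ?F a \<partial>lborel)"
  proof (rule nn_integral_less)
    show "(\<integral>\<^sup>+a. ?G a \<partial>lborel) \<noteq> \<infinity>"
      using fin by (auto simp: nn_integral_average_translates ennreal_mult_eq_top_iff)
    show "AE a in lborel. ?G a \<le> ?F a"
      using ae by eventually_elim simp
    \<comment> \<open>Otherwise a contradiction would hold almost everywhere, although the whole
      space is not null.\<close>
    show "\<not> (AE a in lborel. ?F a \<le> ?G a)"
    proof
      assume "AE a in lborel. ?F a \<le> ?G a"
      with ae have "AE a::'a in lborel. False"
        by eventually_elim simp
      then show False
        by (simp add: AE_iff_measurable[OF _ refl] emeasure_lborel_UNIV)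
    qed
  qed simp_all
  then show False
    by (simp add: nn_integral_average_translates eq)
qed

section \<open>Radial Gaussian moments in the plane\<close>

text \<open>The disc \<open>c * (norm z)\<^sup>2 \<le> s\<close> has area \<open>pi * s / c\<close>,
  linear in \<open>s\<close>, so the image measure has constant density. This takes the place of
  polar coordinates.\<close>

lemma distr_norm_square:
  fixes c :: real
  assumes "c > 0"
  shows "distr (lborel :: (real \<times> real) measure) borel (\<lambda>z. c * (norm z)\<^sup>2)
    = density lborel (\<lambda>s. ennreal (pi / c) * indicator {0..} s)"
proof -
  let ?D = "distr (lborel :: (real \<times> real) measure) borel (\<lambda>z. c * (norm z)\<^sup>2)"
  let ?N = "density lborel (\<lambda>s. ennreal (pi / c) * indicator {0..} s)"
  \<comment> \<open>The maximum covers negative \<open>s\<close>, where the disc is empty.\<close>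
  have D: "emeasure ?D {..s} = ennreal (pi / c * max 0 s)" for s
  proof -
    have "emeasure ?D {..s} = emeasure lborel {z::real \<times> real. c * (norm z)\<^sup>2 \<le> s}"
      by (subst emeasure_distr) (auto simp: vimage_def)
    also have "\<dots> = ennreal (pi / c * max 0 s)"
    proof (cases "s \<ge> 0")
      case True
      have "c * (norm z)\<^sup>2 \<le> s \<longleftrightarrow> norm z \<le> sqrt (s / c)" for z :: "real \<times> real"
        using real_sqrt_le_iff[of "(norm z)\<^sup>2" "s / c"] assms by (simp add: field_simps)
      then have "{z::real \<times> real. c * (norm z)\<^sup>2 \<le> s} = cball 0 (sqrt (s / c))"
        by auto
      then show ?thesis
        using assms True by (simp add: emeasure_cball unit_ball_vol_2)
    next
      case False
      then have empty: "{z::real \<times> real. c * (norm z)\<^sup>2 \<le> s} = {}"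
        using assms by (auto simp: not_le intro: less_le_trans)
      show ?thesis unfolding empty using False by simp
    qed
    finally show ?thesis .
  qed
  have N: "emeasure ?N {..s} = ennreal (pi / c * max 0 s)" for s
  proof -
    have "emeasure ?N {..s} = (\<integral>\<^sup>+t. ennreal (pi / c) * indicator {0..s} t \<partial>lborel)"
      by (subst emeasure_density) (auto intro!: nn_integral_cong split: split_indicator)
    also have "\<dots> = ennreal (pi / c * max 0 s)"
      using assms by (cases "s \<ge> 0") (simp_all add: nn_integral_cmult_indicator ennreal_mult'[symmetric])
    finally show ?thesis .
  qed
  show ?thesis
  proof (rule measure_eqI_generator_eq[where E = "range atMost" and \<Omega> = UNIV and A = "\<lambda>i. {..real i}"])
    show "Int_stable (range atMost :: real set set)"
      by (auto simp: Int_stable_def)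
    show "emeasure ?D X = emeasure ?N X" if "X \<in> range atMost" for X
      using that D N by auto
    show "emeasure ?D {..real i} \<noteq> \<infinity>" for i
      by (simp add: D)
    show "(\<Union>i. {..real i}) = UNIV"
      by (auto intro: real_arch_simple)
  qed (auto simp: borel_eq_atMost)
qed

text \<open>The substitution \<open>s = c * (norm z)\<^sup>2\<close> leads to the Gamma integral of
  \<open>s ^ j * exp (- s)\<close> over the half-line, which is \<open>fact j\<close>.\<close>

lemma nn_integral_radial_gaussian:
  fixes c :: real
  assumes "c > 0"
  shows "(\<integral>\<^sup>+z. ennreal (norm z ^ (2 * j) * exp (- c * (norm z)\<^sup>2)) \<partial>(lborel :: (real \<times> real) measure))
    = ennreal (pi * fact j / c ^ Suc j)"
proof -
  have "(\<integral>\<^sup>+z. ennreal (norm z ^ (2 * j) * exp (- c * (norm z)\<^sup>2)) \<partial>(lborel :: (real \<times> real) measure))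
      = (\<integral>\<^sup>+z. ennreal ((c * (norm z)\<^sup>2) ^ j * exp (- (c * (norm z)\<^sup>2)) / c ^ j) \<partial>(lborel :: (real \<times> real) measure))"
    using assms by (simp add: power_mult_distrib power_mult)
  also have "\<dots> = (\<integral>\<^sup>+s. ennreal (s ^ j * exp (- s) / c ^ j)
      \<partial>distr (lborel :: (real \<times> real) measure) borel (\<lambda>z. c * (norm z)\<^sup>2))"
    by (simp add: nn_integral_distr)
  also have "\<dots> = (\<integral>\<^sup>+s. ennreal (pi / c ^ Suc j) * (ennreal (s ^ j * exp (- s)) * indicator {0..} s) \<partial>lborel)"
    unfolding distr_norm_square[OF assms]
    by (subst nn_integral_density)
       (use assms in \<open>auto intro!: nn_integral_cong split: split_indicator
          simp: ennreal_mult'[symmetric] field_simps\<close>)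
  also have "\<dots> = ennreal (pi * fact j / c ^ Suc j)"
    using assms
    by (simp add: nn_integral_cmult nn_intergal_power_times_exp_Ici ennreal_mult'[symmetric])
  finally show ?thesis .
qed

section \<open>Partial derivatives and smoothness\<close>

definition restrict_fun :: "(real \<times> real) set \<Rightarrow> (real \<times> real \<Rightarrow> complex) \<Rightarrow> real \<times> real \<Rightarrow> complex"
  where "restrict_fun \<Omega> f = (\<lambda>z. if z \<in> \<Omega> then f z else 0)"

lemma eventually_slice_open:
  fixes \<Omega> :: "(real \<times> real) set"
  assumes "open \<Omega>" "(x, y) \<in> \<Omega>"
  shows "\<forall>\<^sub>F t in nhds x. (t, y) \<in> \<Omega>" "\<forall>\<^sub>F t in nhds y. (x, t) \<in> \<Omega>"
proof -
  have "open ((\<lambda>t. (t, y)) -` \<Omega>)" "open ((\<lambda>t. (x, t)) -` \<Omega>)"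
    using assms(1) by (auto intro!: open_vimage continuous_intros)
  then show "\<forall>\<^sub>F t in nhds x. (t, y) \<in> \<Omega>" "\<forall>\<^sub>F t in nhds y. (x, t) \<in> \<Omega>"
    using eventually_nhds_in_open[of "(\<lambda>t. (t, y)) -` \<Omega>" x]
      eventually_nhds_in_open[of "(\<lambda>t. (x, t)) -` \<Omega>" y] assms(2) by simp_all
qed

text \<open>Near a point of an open set the coordinate slices stay inside it, so extension by zero
  leaves the partial derivatives there unchanged.\<close>

lemma partial_eq_on_open:
  assumes \<Omega>: "open \<Omega>" "(x, y) \<in> \<Omega>" and eq: "\<And>w. w \<in> \<Omega> \<Longrightarrow> U w = f w"
  shows has_partial_x_cong: "((\<lambda>t. f (t, y)) has_vector_derivative D) (at x)
      \<Longrightarrow> ((\<lambda>t. U (t, y)) has_vector_derivative D) (at x)"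
    and has_partial_y_cong: "((\<lambda>t. f (x, t)) has_vector_derivative D) (at y)
      \<Longrightarrow> ((\<lambda>t. U (x, t)) has_vector_derivative D) (at y)"
proof -
  have "\<forall>\<^sub>F t in nhds x. U (t, y) = f (t, y)" "\<forall>\<^sub>F t in nhds y. U (x, t) = f (x, t)"
    using eventually_slice_open[OF \<Omega>] by (auto elim!: eventually_mono simp: eq)
  then show "((\<lambda>t. f (t, y)) has_vector_derivative D) (at x)
      \<Longrightarrow> ((\<lambda>t. U (t, y)) has_vector_derivative D) (at x)"
    "((\<lambda>t. f (x, t)) has_vector_derivative D) (at y)
      \<Longrightarrow> ((\<lambda>t. U (x, t)) has_vector_derivative D) (at y)"
    using \<Omega>(2) by (simp_all add: has_vector_derivative_cong_ev eq)
qed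

lemma pdx_eqI: "((\<lambda>t. U (t, y)) has_vector_derivative D) (at x) \<Longrightarrow> pdx U (x, y) = D"
  by (simp add: pdx_def vector_derivative_at)

lemma pdy_eqI: "((\<lambda>t. U (x, t)) has_vector_derivative D) (at y) \<Longrightarrow> pdy U (x, y) = D"
  by (simp add: pdy_def vector_derivative_at)

text \<open>A class of smooth functions that is visibly closed under both partial derivatives.\<close>

inductive elementary :: "(real \<times> real \<Rightarrow> complex) \<Rightarrow> bool" where
  const: "elementary (\<lambda>_. c)"
| fst: "elementary (\<lambda>z. of_real (fst z))"
| snd: "elementary (\<lambda>z. of_real (snd z))"
| add: "elementary f \<Longrightarrow> elementary g \<Longrightarrow> elementary (\<lambda>z. f z + g z)"
| mult: "elementary f \<Longrightarrow> elementary g \<Longrightarrow> elementary (\<lambda>z. f z * g z)"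
| exp: "elementary f \<Longrightarrow> elementary (\<lambda>z. exp (f z))"

lemma elementary_power: "elementary f \<Longrightarrow> elementary (\<lambda>z. f z ^ n)"
  by (induction n) (auto intro: elementary.intros)

lemma elementary_continuous: "elementary f \<Longrightarrow> continuous_on S f"
  by (induction rule: elementary.induct) (auto intro!: continuous_intros)

lemma elementary_partial_x:
  "elementary f \<Longrightarrow> \<exists>g. elementary g \<and> (\<forall>x y. ((\<lambda>t. f (t, y)) has_vector_derivative g (x, y)) (at x))"
proof (induction rule: elementary.induct)
  case (const c)
  then show ?case by (auto intro!: exI[of _ "\<lambda>_. 0"] elementary.intros derivative_eq_intros)
next
  case fst
  then show ?case by (auto intro!: exI[of _ "\<lambda>_. 1"] elementary.intros derivative_eq_intros)
next
  case snd
  then show ?case by (auto intro!: exI[of _ "\<lambda>_. 0"] elementary.intros derivative_eq_intros)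
next
  case (add f g)
  then obtain f' g' where "elementary f'" "elementary g'"
    "\<And>x y. ((\<lambda>t. f (t, y)) has_vector_derivative f' (x, y)) (at x)"
    "\<And>x y. ((\<lambda>t. g (t, y)) has_vector_derivative g' (x, y)) (at x)" by blast
  then show ?case
    by (intro exI[of _ "\<lambda>z. f' z + g' z"]) (auto intro!: elementary.intros derivative_intros)
next
  case (mult f g)
  then obtain f' g' where "elementary f'" "elementary g'"
    "\<And>x y. ((\<lambda>t. f (t, y)) has_vector_derivative f' (x, y)) (at x)"
    "\<And>x y. ((\<lambda>t. g (t, y)) has_vector_derivative g' (x, y)) (at x)" by blast
  with mult show ?case
    by (intro exI[of _ "\<lambda>z. f z * g' z + f' z * g z"])
       (auto intro!: elementary.intros has_vector_derivative_mult)
next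
  case (exp f)
  then obtain f' where f': "elementary f'"
    "\<And>x y. ((\<lambda>t. f (t, y)) has_vector_derivative f' (x, y)) (at x)" by blast
  have "((\<lambda>t. exp (f (t, y))) has_vector_derivative f' (x, y) * exp (f (x, y))) (at x)" for x y
    using field_vector_diff_chain_at[OF f'(2)[where x = x and y = y] DERIV_exp] by (simp add: o_def)
  with exp f' show ?case
    by (intro exI[of _ "\<lambda>z. f' z * exp (f z)"]) (auto intro!: elementary.intros)
qed

lemma elementary_swap: "elementary f \<Longrightarrow> elementary (\<lambda>z. f (prod.swap z))"
  by (induction rule: elementary.induct) (auto intro: elementary.intros)

text \<open>Exchanging the coordinates preserves the class and reduces this to the derivative in the
  first variable.\<close>

lemma elementary_partial_y:
  assumes "elementary f"
  shows "\<exists>g. elementary g \<and> (\<forall>x y. ((\<lambda>t. f (x, t)) has_vector_derivative g (x, y)) (at y))"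
proof -
  obtain g where "elementary g"
    "\<forall>x y. ((\<lambda>t. f (prod.swap (t, y))) has_vector_derivative g (x, y)) (at x)"
    using elementary_partial_x[OF elementary_swap[OF assms]] by blast
  then show ?thesis
    by (intro exI[of _ "\<lambda>z. g (prod.swap z)"]) (auto intro: elementary_swap)
qed

text \<open>Agreement is required on \<open>\<Omega>\<close> only, which is what the induction can
  maintain: \<open>pdx U\<close> and \<open>pdy U\<close> are known to be elementary there, but not
  outside.\<close>

lemma Ck_on_elementary:
  assumes "open \<Omega>" "elementary f" "\<And>w. w \<in> \<Omega> \<Longrightarrow> U w = f w"
  shows "Ck_on n \<Omega> U"
  using assms(2,3)
proof (induction n arbitrary: f U)
  case 0
  then show ?case by (simp add: elementary_continuous cong: continuous_on_cong)
next
  case (Suc n)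
  obtain fx fy where fx: "elementary fx" "\<And>x y. ((\<lambda>t. f (t, y)) has_vector_derivative fx (x, y)) (at x)"
    and fy: "elementary fy" "\<And>x y. ((\<lambda>t. f (x, t)) has_vector_derivative fy (x, y)) (at y)"
    using elementary_partial_x[OF Suc.prems(1)] elementary_partial_y[OF Suc.prems(1)] by blast
  have dx: "((\<lambda>t. U (t, y)) has_vector_derivative fx (x, y)) (at x)"
    and dy: "((\<lambda>t. U (x, t)) has_vector_derivative fy (x, y)) (at y)" if "(x, y) \<in> \<Omega>" for x y
    using has_partial_x_cong[OF assms(1) that Suc.prems(2) fx(2)]
      has_partial_y_cong[OF assms(1) that Suc.prems(2) fy(2)] by auto
  have "Ck_on n \<Omega> (pdx U)" "Ck_on n \<Omega> (pdy U)"
    by (rule Suc.IH[OF fx(1)]; use pdx_eqI[OF dx] in force)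
       (rule Suc.IH[OF fy(1)]; use pdy_eqI[OF dy] in force)
  moreover have "continuous_on \<Omega> U"
    using Suc.prems by (simp add: elementary_continuous cong: continuous_on_cong)
  ultimately show ?case
    by (auto intro: differentiableI_vector[OF dx] differentiableI_vector[OF dy])
qed

section \<open>Translated Landau states\<close>

definition plane_to_complex :: "real \<times> real \<Rightarrow> complex"
  where "plane_to_complex z = Complex (fst z) (snd z)"

text \<open>Up to a constant phase this is the magnetic translate by \<open>a\<close> of the Landau state
  \<open>cnj z ^ n * exp (- B |z|\<^sup>2 / 4)\<close>.\<close>

definition landau_state :: "real \<Rightarrow> nat \<Rightarrow> real \<times> real \<Rightarrow> real \<times> real \<Rightarrow> complex"
  where "landau_state B n a z = cnj (plane_to_complex (z - a)) ^ n *
    exp (of_real (B / 2) * cnj (plane_to_complex a) * plane_to_complex z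
      - of_real (B / 4 * ((norm z)\<^sup>2 + (norm a)\<^sup>2)))"

lemma landau_state_Pair:
  "landau_state B n (a, b) (x, y) = (of_real x - \<i> * of_real y - (of_real a - \<i> * of_real b)) ^ n *
    exp (of_real (B / 2) * (of_real a - \<i> * of_real b) * (of_real x + \<i> * of_real y)
      - of_real B / 4 * ((of_real x)\<^sup>2 + (of_real y)\<^sup>2 + (of_real a)\<^sup>2 + (of_real b)\<^sup>2))"
proof -
  have 1: "plane_to_complex (u, v) = of_real u + \<i> * of_real v" for u v
    by (simp add: plane_to_complex_def complex_eq_iff)
  show ?thesis
    by (simp add: landau_state_def 1 norm_Pair algebra_simps)
qed

lemma elementary_landau_state: "elementary (landau_state B n a)"
proof -
  \<comment> \<open>Subtraction and division are confined to factors independent of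
    \<open>z\<close>, so that the closure rules for sums, products, powers and \<open>exp\<close>
    apply.\<close>
  have "landau_state B n a = (\<lambda>z. (of_real (fst z) + ((- \<i>) * of_real (snd z)
      + (- of_real (fst a) + \<i> * of_real (snd a)))) ^ n *
    exp ((of_real (B / 2) * (of_real (fst a) - \<i> * of_real (snd a))) * (of_real (fst z) + \<i> * of_real (snd z))
      + (- of_real B / 4) * ((of_real (fst z))\<^sup>2 + ((of_real (snd z))\<^sup>2 + ((of_real (fst a))\<^sup>2 + (of_real (snd a))\<^sup>2)))))"
    by (rule ext) (cases a; auto simp: landau_state_Pair algebra_simps)
  then show ?thesis
    by (simp only:) (intro elementary.mult elementary_power elementary.add elementary.exp elementary.intros)
qed

text \<open>Since \<open>Re (cnj a * z)\<close> is the inner product of \<open>a\<close> and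
  \<open>z\<close>, completing the square makes the real part of the exponent
  \<open>- (B / 4) * (norm (z - a))\<^sup>2\<close>. Hence the modulus depends on
  \<open>z - a\<close> alone, as the averaging argument requires.\<close>

lemma norm_landau_state:
  "norm (landau_state B n a z) ^ 2 = norm (z - a) ^ (2 * n) * exp (- (B / 2) * (norm (z - a))\<^sup>2)"
proof -
  obtain x y a1 a2 where [simp]: "z = (x, y)" "a = (a1, a2)" by (cases z, cases a) auto
  have "norm (plane_to_complex w) = norm w" for w
    by (cases w) (simp add: plane_to_complex_def norm_Pair cmod_def)
  then have "norm (landau_state B n a z) ^ 2 = norm (z - a) ^ (2 * n) *
      exp (Re (of_real (B / 2) * cnj (plane_to_complex a) * plane_to_complex z
      - of_real (B / 4 * ((norm z)\<^sup>2 + (norm a)\<^sup>2)))) ^ 2"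
    unfolding landau_state_def
    by (simp only: norm_mult norm_power complex_mod_cnj norm_exp_eq_Re power_mult_distrib
        power_mult[symmetric] mult.commute[of n 2])
  also have "exp (Re (of_real (B / 2) * cnj (plane_to_complex a) * plane_to_complex z
      - of_real (B / 4 * ((norm z)\<^sup>2 + (norm a)\<^sup>2)))) ^ 2 = exp (- (B / 2) * (norm (z - a))\<^sup>2)"
    by (simp add: exp_double[symmetric] plane_to_complex_def norm_Pair)
       (simp add: power2_eq_square field_simps)
  finally show ?thesis .
qed

section \<open>Partial derivatives of the Landau states\<close>

lemma has_field_derivative_power_times_gaussian:
  fixes X :: complex
  shows "((\<lambda>X. (c * X + p) ^ n * exp (q * X + r - b * X\<^sup>2)) has_field_derivative
    of_nat n * c * ((c * X + p) ^ (n - 1) * exp (q * X + r - b * X\<^sup>2))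
    + (q - 2 * b * X) * ((c * X + p) ^ n * exp (q * X + r - b * X\<^sup>2))) (at X)"
  by (rule derivative_eq_intros refl | simp add: algebra_simps)+

text \<open>The truncated index \<open>n - 1\<close> is harmless at \<open>n = 0\<close>, because
  its term carries the factor \<open>n\<close>.\<close>

lemma landau_state_has_partial_x:
  "((\<lambda>t. landau_state B n a (t, y)) has_vector_derivative
     of_nat n * landau_state B (n - 1) a (x, y)
     + of_real (B / 2) * (cnj (plane_to_complex a) - of_real x) * landau_state B n a (x, y)) (at x)"
proof -
  obtain a1 a2 where a: "a = (a1, a2)" by (cases a)
  \<comment> \<open>For fixed \<open>y\<close>, \<open>p\<close> is the constant part of
    \<open>cnj (z - a)\<close>, and \<open>q\<close>, \<open>r\<close>, \<open>b\<close> are the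
    coefficients of the exponent as a quadratic in the first coordinate.\<close>
  define p q r b :: complex
    where "p = - \<i> * of_real y - (of_real a1 - \<i> * of_real a2)"
      and "q = of_real (B / 2) * (of_real a1 - \<i> * of_real a2)"
      and "r = of_real (B / 2) * (of_real a1 - \<i> * of_real a2) * (\<i> * of_real y)
             - of_real B / 4 * ((of_real y)\<^sup>2 + (of_real a1)\<^sup>2 + (of_real a2)\<^sup>2)"
      and "b = of_real B / 4"
  have *: "landau_state B m a (t, y)
      = (1 * of_real t + p) ^ m * exp (q * of_real t + r - b * (of_real t)\<^sup>2)" for m t
    unfolding a landau_state_Pair p_def q_def r_def b_def
    by (intro arg_cong2[where f = "(*)"] arg_cong[where f = exp] arg_cong[where f = "\<lambda>w. w ^ m"];
        simp add: field_simps)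
  show ?thesis
    unfolding *
    by (rule has_vector_derivative_eq_rhs[OF has_vector_derivative_real_field[OF
          has_field_derivative_power_times_gaussian]])
       (simp add: q_def b_def a plane_to_complex_def Complex_eq algebra_simps)
qed

lemma landau_state_has_partial_y:
  "((\<lambda>t. landau_state B n a (x, t)) has_vector_derivative
     - \<i> * of_nat n * landau_state B (n - 1) a (x, y)
     + of_real (B / 2) * (\<i> * cnj (plane_to_complex a) - of_real y) * landau_state B n a (x, y)) (at y)"
proof -
  obtain a1 a2 where a: "a = (a1, a2)" by (cases a)
  \<comment> \<open>For fixed \<open>x\<close> the linear factor has slope \<open>- \<i>\<close>,
    and the linear coefficient \<open>q\<close> of the exponent gains a factor
    \<open>\<i>\<close>.\<close>
  define p q r b :: complex
    where "p = of_real x - (of_real a1 - \<i> * of_real a2)"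
      and "q = \<i> * of_real (B / 2) * (of_real a1 - \<i> * of_real a2)"
      and "r = of_real (B / 2) * (of_real a1 - \<i> * of_real a2) * of_real x
             - of_real B / 4 * ((of_real x)\<^sup>2 + (of_real a1)\<^sup>2 + (of_real a2)\<^sup>2)"
      and "b = of_real B / 4"
  have *: "landau_state B m a (x, t)
      = (- \<i> * of_real t + p) ^ m * exp (q * of_real t + r - b * (of_real t)\<^sup>2)" for m t
    unfolding a landau_state_Pair p_def q_def r_def b_def
    by (intro arg_cong2[where f = "(*)"] arg_cong[where f = exp] arg_cong[where f = "\<lambda>w. w ^ m"];
        simp add: field_simps)
  show ?thesis
    unfolding *
    by (rule has_vector_derivative_eq_rhs[OF has_vector_derivative_real_field[OF
          has_field_derivative_power_times_gaussian]])
       (simp add: q_def b_def a plane_to_complex_def Complex_eq algebra_simps)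
qed

section \<open>The magnetic derivatives as raising and lowering of the index\<close>

lemma landau_state_Suc:
  "landau_state B (Suc n) a z = cnj (plane_to_complex z - plane_to_complex a) * landau_state B n a z"
  by (simp add: landau_state_def plane_to_complex_def complex_eq_iff algebra_simps)

text \<open>The vector potential and the derivative of the exponential combine into a multiple of
  \<open>cnj (z - a)\<close>, which raises the index; the derivative of the power lowers it.
  Two-term combinations are treated because one application to a single state already produces two
  terms, to which \<open>mag_op\<close> applies the operator again.\<close>

lemma mag_x_landau_combination:
  assumes "open \<Omega>" "z \<in> \<Omega>"
    and "\<And>w. w \<in> \<Omega> \<Longrightarrow> U w = c * landau_state B m a w + d * landau_state B n a w"
  shows "mag_x B U z = \<i> * c * (of_real (B / 2) * landau_state B (Suc m) a z - of_nat m * landau_state B (m - 1) a z)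
    + \<i> * d * (of_real (B / 2) * landau_state B (Suc n) a z - of_nat n * landau_state B (n - 1) a z)"
proof -
  obtain x y where z: "z = (x, y)" by (cases z)
  have partial: "pdx U z = c * (of_nat m * landau_state B (m - 1) a z
        + of_real (B / 2) * (cnj (plane_to_complex a) - of_real x) * landau_state B m a z)
      + d * (of_nat n * landau_state B (n - 1) a z
        + of_real (B / 2) * (cnj (plane_to_complex a) - of_real x) * landau_state B n a z)"
    unfolding z
    by (rule pdx_eqI, rule has_partial_x_cong[OF assms(1) assms(2)[unfolded z] assms(3)], assumption)
       (rule has_vector_derivative_add has_vector_derivative_mult_right landau_state_has_partial_x)+
  show ?thesis
    unfolding mag_x_def partial assms(3)[OF assms(2)] landau_state_Suc
    by (simp add: z vec_pot_def plane_to_complex_def Complex_eq field_simps)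
qed

lemma mag_y_landau_combination:
  assumes "open \<Omega>" "z \<in> \<Omega>"
    and "\<And>w. w \<in> \<Omega> \<Longrightarrow> U w = c * landau_state B m a w + d * landau_state B n a w"
  shows "mag_y B U z = - c * (of_real (B / 2) * landau_state B (Suc m) a z + of_nat m * landau_state B (m - 1) a z)
    - d * (of_real (B / 2) * landau_state B (Suc n) a z + of_nat n * landau_state B (n - 1) a z)"
proof -
  obtain x y where z: "z = (x, y)" by (cases z)
  have partial: "pdy U z = c * (- \<i> * of_nat m * landau_state B (m - 1) a z
        + of_real (B / 2) * (\<i> * cnj (plane_to_complex a) - of_real y) * landau_state B m a z)
      + d * (- \<i> * of_nat n * landau_state B (n - 1) a z
        + of_real (B / 2) * (\<i> * cnj (plane_to_complex a) - of_real y) * landau_state B n a z)"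
    unfolding z
    by (rule pdy_eqI, rule has_partial_y_cong[OF assms(1) assms(2)[unfolded z] assms(3)], assumption)
       (rule has_vector_derivative_add has_vector_derivative_mult_right landau_state_has_partial_y)+
  show ?thesis
    unfolding mag_y_def partial assms(3)[OF assms(2)] landau_state_Suc
    by (simp add: z vec_pot_def plane_to_complex_def Complex_eq field_simps)
qed

context
  fixes \<Omega> :: "(real \<times> real) set" and U :: "real \<times> real \<Rightarrow> complex" and B :: real and n :: nat and a
  assumes \<Omega>: "open \<Omega>" and U: "\<And>w. w \<in> \<Omega> \<Longrightarrow> U w = landau_state B n a w"
begin

lemma mag_x_landau_state:
  assumes "z \<in> \<Omega>"
  shows "mag_x B U z = (\<i> * of_real (B / 2)) * landau_state B (Suc n) a z + (- \<i> * of_nat n) * landau_state B (n - 1) a z"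
  by (subst mag_x_landau_combination[OF \<Omega> assms, of U 1 _ n a 0 n]) (auto simp: U algebra_simps)

lemma mag_y_landau_state:
  assumes "z \<in> \<Omega>"
  shows "mag_y B U z = (- of_real (B / 2)) * landau_state B (Suc n) a z + (- of_nat n) * landau_state B (n - 1) a z"
  by (subst mag_y_landau_combination[OF \<Omega> assms, of U 1 _ n a 0 n]) (auto simp: U algebra_simps)

text \<open>In the sum of the two squares the terms of index \<open>n + 2\<close> and
  \<open>n - 2\<close> cancel. Going up and then down contributes \<open>B * (n + 1)\<close>, going
  down and then up \<open>B * n\<close>.\<close>

lemma mag_op_landau_state:
  assumes "z \<in> \<Omega>"
  shows "mag_op B U z = of_real (B * (2 * real n + 1)) * U z"
proof -
  have "mag_op B U z = of_real B * (of_nat (Suc n) * landau_state B n a z)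
      + of_real B * (of_nat n * landau_state B (Suc (n - 1)) a z)"
    unfolding mag_op_def
    by (subst mag_x_landau_combination[OF \<Omega> assms mag_x_landau_state], assumption,
        subst mag_y_landau_combination[OF \<Omega> assms mag_y_landau_state], assumption)
       (simp add: field_simps)
  \<comment> \<open>\<open>Suc (n - 1)\<close> differs from \<open>n\<close> only for
    \<open>n = 0\<close>, where its coefficient vanishes.\<close>
  also have "\<dots> = of_real (B * (2 * real n + 1)) * U z"
    using U[OF assms] by (cases n) (simp_all add: algebra_simps)
  finally show ?thesis .
qed

text \<open>The components are \<open>u - v\<close> and \<open>u + v\<close> up to unimodular
  factors, so the parallelogram law removes the cross terms. What remains involves only moduli of
  states, hence only \<open>z - a\<close>.\<close>

lemma norm_mag_grad_landau_state:
  assumes "z \<in> \<Omega>"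
  shows "(norm (mag_grad B U z))\<^sup>2
    = 2 * (real n)\<^sup>2 * (norm (landau_state B (n - 1) a z))\<^sup>2 + B\<^sup>2 / 2 * (norm (landau_state B (Suc n) a z))\<^sup>2"
proof -
  define u v where "u = of_real (B / 2) * landau_state B (Suc n) a z"
    and "v = of_nat n * landau_state B (n - 1) a z"
  have "mag_x B U z = \<i> * (u - v)" "mag_y B U z = - (u + v)"
    unfolding mag_x_landau_state[OF assms] mag_y_landau_state[OF assms] u_def v_def
    by (simp_all add: algebra_simps)
  then have "(norm (mag_grad B U z))\<^sup>2 = (norm (u - v))\<^sup>2 + (norm (u + v))\<^sup>2"
    by (simp add: mag_grad_def norm_Pair norm_mult norm_minus_cancel[of "u + v"] del: minus_add_distrib)
  also have "\<dots> = 2 * (norm v)\<^sup>2 + 2 * (norm u)\<^sup>2"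
    by (simp add: power2_norm_eq_inner inner_simps inner_commute)
  finally show ?thesis
    by (simp add: u_def v_def norm_mult power_mult_distrib power_divide)
qed

end

section \<open>Linear independence of distinct translates\<close>

text \<open>The states are eigenvectors of \<open>\<partial>\<^sub>z + B cnj z / 4\<close> with the distinct eigenvalues \<open>B cnj a / 2\<close>.\<close>

lemma landau_combination_eigenvalue:
  assumes "open \<Omega>" "B \<noteq> 0" "finite A"
    and zero: "\<And>z. z \<in> \<Omega> \<Longrightarrow> (\<Sum>a\<in>A. c a * landau_state B n a z) = 0" and z: "z \<in> \<Omega>"
  shows "(\<Sum>a\<in>A. c a * cnj (plane_to_complex a) * landau_state B n a z) = 0"
proof -
  obtain x y where z_eq: "z = (x, y)" by (cases z)
  note xy = z[unfolded z_eq]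
  define f where "f = (\<lambda>z. \<Sum>a\<in>A. c a * landau_state B n a z)"
  have "((\<lambda>t. f (t, y)) has_vector_derivative 0) (at x)"
    by (rule has_partial_x_cong[OF assms(1) xy, of f "\<lambda>_. 0"]) (auto simp: f_def zero)
  moreover have "((\<lambda>t. f (t, y)) has_vector_derivative (\<Sum>a\<in>A. c a * (of_nat n * landau_state B (n - 1) a (x, y)
     + of_real (B / 2) * (cnj (plane_to_complex a) - of_real x) * landau_state B n a (x, y)))) (at x)"
    unfolding f_def
    by (intro has_vector_derivative_sum has_vector_derivative_mult_right landau_state_has_partial_x)
  ultimately have 1: "(\<Sum>a\<in>A. c a * (of_nat n * landau_state B (n - 1) a z
     + of_real (B / 2) * (cnj (plane_to_complex a) - of_real x) * landau_state B n a z)) = 0"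
    using vector_derivative_unique_at unfolding z_eq by blast
  have "((\<lambda>t. f (x, t)) has_vector_derivative 0) (at y)"
    by (rule has_partial_y_cong[OF assms(1) xy, of f "\<lambda>_. 0"]) (auto simp: f_def zero)
  moreover have "((\<lambda>t. f (x, t)) has_vector_derivative (\<Sum>a\<in>A. c a * (- \<i> * of_nat n * landau_state B (n - 1) a (x, y)
     + of_real (B / 2) * (\<i> * cnj (plane_to_complex a) - of_real y) * landau_state B n a (x, y)))) (at y)"
    unfolding f_def
    by (intro has_vector_derivative_sum has_vector_derivative_mult_right landau_state_has_partial_y)
  ultimately have 2: "(\<Sum>a\<in>A. c a * (- \<i> * of_nat n * landau_state B (n - 1) a z
     + of_real (B / 2) * (\<i> * cnj (plane_to_complex a) - of_real y) * landau_state B n a z)) = 0"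
    using vector_derivative_unique_at unfolding z_eq by blast
  \<comment> \<open>In the combination of the \<open>x\<close>-derivative minus \<open>\<i>\<close>
    times the \<open>y\<close>-derivative the terms of index \<open>n - 1\<close> cancel. The last
    summand removes the dependence on \<open>x\<close> and \<open>y\<close> from the remaining
    factor.\<close>
  have "of_real B * (\<Sum>a\<in>A. c a * cnj (plane_to_complex a) * landau_state B n a z)
    = (\<Sum>a\<in>A. c a * (of_nat n * landau_state B (n - 1) a z
        + of_real (B / 2) * (cnj (plane_to_complex a) - of_real x) * landau_state B n a z))
      - \<i> * (\<Sum>a\<in>A. c a * (- \<i> * of_nat n * landau_state B (n - 1) a z
        + of_real (B / 2) * (\<i> * cnj (plane_to_complex a) - of_real y) * landau_state B n a z))
      + of_real (B / 2) * (of_real x - \<i> * of_real y) * (\<Sum>a\<in>A. c a * landau_state B n a z)"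
    unfolding sum_distrib_left sum_subtractf[symmetric] sum.distrib[symmetric]
    by (rule sum.cong[OF refl]) (simp add: field_simps)
  then show ?thesis
    using 1 2 zero[OF z] assms(2) by simp
qed

text \<open>The usual argument for eigenvectors with distinct eigenvalues: applying the operator and
  subtracting the eigenvalue of \<open>b\<close> times the relation eliminates \<open>b\<close>, and
  induction applies to the rest.\<close>

lemma landau_states_independent:
  assumes "open \<Omega>" "\<Omega> \<noteq> {}" "B \<noteq> 0" "finite A"
    and "\<And>z. z \<in> \<Omega> \<Longrightarrow> (\<Sum>a\<in>A. c a * landau_state B n a z) = 0"
    and "a \<in> A"
  shows "c a = 0"
  using assms(4-)
proof (induction A arbitrary: c a)
  case empty
  then show ?case by simp
next
  case (insert b A)
  let ?e = "\<lambda>a. cnj (plane_to_complex a)"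
  have A: "c d = 0" if "d \<in> A" for d
  proof -
    have "(\<Sum>a\<in>A. (c a * (?e a - ?e b)) * landau_state B n a z) = 0" if z: "z \<in> \<Omega>" for z
    proof -
      have "(\<Sum>a\<in>insert b A. (c a * (?e a - ?e b)) * landau_state B n a z)
          = (\<Sum>a\<in>insert b A. c a * ?e a * landau_state B n a z)
            - ?e b * (\<Sum>a\<in>insert b A. c a * landau_state B n a z)"
        unfolding sum_distrib_left sum_subtractf[symmetric]
        by (rule sum.cong[OF refl]) (simp add: algebra_simps)
      also have "\<dots> = 0"
        using landau_combination_eigenvalue[OF assms(1,3) _ insert.prems(1) z] insert.prems(1)[OF z]
          insert.hyps(1) by simp
      finally show ?thesis
        using insert.hyps by simp
    qed
    from insert.IH[OF this \<open>d \<in> A\<close>] have "c d * (?e d - ?e b) = 0" .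
    moreover have "?e d \<noteq> ?e b"
    proof -
      have "d \<noteq> b" using insert.hyps(2) that by auto
      then show ?thesis by (simp add: plane_to_complex_def complex_eq_iff prod_eq_iff)
    qed
    ultimately show ?thesis by simp
  qed
  \<comment> \<open>Only the term of \<open>b\<close> is left. Its state may vanish at
    \<open>z = b\<close>, so another point of \<open>\<Omega>\<close> is chosen.\<close>
  have "infinite \<Omega>"
    using assms(1,2) finite_imp_not_open by blast
  then obtain z where z: "z \<in> \<Omega>" "z \<noteq> b"
    by (metis finite.emptyI finite.insertI finite_subset insertCI subsetI)
  then have "plane_to_complex (z - b) \<noteq> 0"
    by (auto simp: plane_to_complex_def complex_eq_iff prod_eq_iff)
  then have "landau_state B n b z \<noteq> 0"
    by (simp add: landau_state_def)
  moreover have "c b * landau_state B n b z = 0"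
    using insert.prems(1)[OF z(1)] insert.hyps A by simp
  ultimately show ?case
    using A insert.prems(2) by (metis insertE mult_eq_0_iff)
qed

lemma inj_restrict_landau_state:
  assumes "open \<Omega>" "\<Omega> \<noteq> {}" "B \<noteq> 0"
  shows "inj (\<lambda>a. restrict_fun \<Omega> (landau_state B n a))"
proof (rule injI, rule ccontr)
  fix a b
  assume eq: "restrict_fun \<Omega> (landau_state B n a) = restrict_fun \<Omega> (landau_state B n b)" and "a \<noteq> b"
  have "landau_state B n a z = landau_state B n b z" if "z \<in> \<Omega>" for z
    using fun_cong[OF eq, of z] that by (simp add: restrict_fun_def)
  \<comment> \<open>Equality of the two states is a linear relation on \<open>{a, b}\<close> with
    coefficients 1 and -1.\<close>
  then have "(if a = a then 1 else - 1 :: complex) = 0"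
    using \<open>a \<noteq> b\<close>
    by (intro landau_states_independent[OF assms, of "{a, b}" "\<lambda>d. if d = a then 1 else - 1" n a]) auto
  then show False by simp
qed

lemma sum_fun_eval: "sum f A x = (\<Sum>a\<in>A. f a x)"
  for f :: "'a \<Rightarrow> 'b \<Rightarrow> 'c::comm_monoid_add"
  by (induction A rule: infinite_finite_induct) auto

lemma independent_restrict_landau_states:
  assumes "open \<Omega>" "\<Omega> \<noteq> {}" "B \<noteq> 0"
  shows "cfun.independent ((\<lambda>a. restrict_fun \<Omega> (landau_state B n a)) ` S)"
  unfolding cfun.independent_explicit_module
proof (intro allI impI)
  fix t u v
  let ?U = "\<lambda>a. restrict_fun \<Omega> (landau_state B n a)"
  assume t: "finite t" "t \<subseteq> ?U ` S" and sum: "(\<Sum>v\<in>t. (\<lambda>z. u v * v z)) = 0" and "v \<in> t"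
  obtain A where A: "finite A" "t = ?U ` A"
    using finite_subset_image[OF t] by blast
  \<comment> \<open>Injectivity turns a relation between functions into one between states indexed
    by translation points.\<close>
  have inj: "inj_on ?U A"
    using inj_restrict_landau_state[OF assms] inj_on_subset by blast
  obtain a where a: "a \<in> A" "v = ?U a" using \<open>v \<in> t\<close> A by blast
  have "(\<Sum>a\<in>A. u (?U a) * landau_state B n a z) = 0" if "z \<in> \<Omega>" for z
  proof -
    have "(\<Sum>v\<in>t. u v * v z) = 0"
      using fun_cong[OF sum, of z] by (simp add: sum_fun_eval)
    moreover have "?U a z = landau_state B n a z" for a
      using that by (simp add: restrict_fun_def)
    ultimately show ?thesis
      by (simp add: A(2) sum.reindex[OF inj])
  qed
  from landau_states_independent[OF assms A(1) this a(1)] show "u v = 0"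
    using a by simp
qed

section \<open>Smoothness and square integrability\<close>

lemma restrict_landau_state_C_infinity:
  "open \<Omega> \<Longrightarrow> restrict_fun \<Omega> (landau_state B n a) \<in> C_infinity \<Omega>"
  unfolding C_infinity_def functions_on_def
  using Ck_on_elementary[OF _ elementary_landau_state] by (auto simp: restrict_fun_def)

text \<open>The state is square integrable on the whole plane, by the Gaussian moment of order
  \<open>n\<close>.\<close>

lemma restrict_landau_state_L2:
  assumes "open \<Omega>" "B > 0"
  shows "restrict_fun \<Omega> (landau_state B n a) \<in> L2 \<Omega>"
proof -
  have [measurable]: "landau_state B n a \<in> borel_measurable borel" "\<Omega> \<in> sets borel"
    using borel_measurable_continuous_onI[OF elementary_continuous[OF elementary_landau_state]] assms(1)
    by auto
  have eq: "indicator \<Omega> z *\<^sub>R restrict_fun \<Omega> (landau_state B n a) z = indicator \<Omega> z *\<^sub>R landau_state B n a z"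
    "indicator \<Omega> z *\<^sub>R (norm (restrict_fun \<Omega> (landau_state B n a) z))\<^sup>2
      = indicator \<Omega> z *\<^sub>R (norm (landau_state B n a z))\<^sup>2" for z
    by (simp_all add: restrict_fun_def indicator_def)
  let ?g = "\<lambda>w. ennreal (norm w ^ (2 * n) * exp (- (B / 2) * (norm w)\<^sup>2))"
  have "(\<integral>\<^sup>+z. ennreal ((norm (landau_state B n a z))\<^sup>2) \<partial>lborel) = (\<integral>\<^sup>+z. ?g (a - z) \<partial>lborel)"
    by (simp add: norm_landau_state norm_minus_commute)
  also have "\<dots> < \<infinity>"
    using nn_integral_radial_gaussian[of "B / 2" n] assms(2)
    by (subst nn_integral_lborel_reflect_translate) auto
  finally have "integrable lborel (\<lambda>z. (norm (landau_state B n a z))\<^sup>2)"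
    by (intro integrableI_bounded) auto
  then have "integrable lebesgue (\<lambda>z. (norm (landau_state B n a z))\<^sup>2)"
    by (simp add: integrable_completion)
  then have "set_integrable lebesgue \<Omega> (\<lambda>z. (norm (landau_state B n a z))\<^sup>2)"
    unfolding set_integrable_def by (rule integrable_mult_indicator[rotated]) simp
  moreover have "set_borel_measurable lebesgue \<Omega> (landau_state B n a)"
    unfolding set_borel_measurable_def by (intro measurable_completion) simp
  ultimately show ?thesis
    unfolding L2_def functions_on_def set_integrable_def set_borel_measurable_def
    by (simp only: eq mem_Collect_eq) (simp add: restrict_fun_def)
qed

section \<open>Selecting the translates that satisfy the energy bound\<close>

theorem proposition2p1:
  fixes B :: real and k :: nat and \<Omega> :: "(real \<times> real) set"
  assumes "B > 0" and "k \<ge> 1"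
    and "open \<Omega>" and "connected \<Omega>" and "\<Omega> \<noteq> {}"
    and "emeasure lebesgue \<Omega> < \<infinity>"
  shows "\<exists>F. infinite F \<and> cfun.independent F \<and> F \<subseteq> C_infinity \<Omega> \<inter> L2 \<Omega> \<and>
    (\<forall>U\<in>F. (\<forall>z\<in>\<Omega>. mag_op B U z = of_real (B * (2 * real k - 1)) * U z) \<and>
       (\<integral>\<^sup>+z\<in>\<Omega>. ennreal ((norm (mag_grad B U z))\<^sup>2) \<partial>lebesgue)
         \<le> ennreal (B * (2 * real k - 1)) * (\<integral>\<^sup>+z\<in>\<Omega>. ennreal ((norm (U z))\<^sup>2) \<partial>lebesgue))"
proof -
  \<comment> \<open>Levels are counted from 1, powers of \<open>cnj z\<close> from 0.\<close>
  define n where "n = k - 1"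
  have k: "2 * real k - 1 = 2 * real n + 1"
    using assms(2) by (simp add: n_def of_nat_diff)
  have [measurable]: "\<Omega> \<in> sets borel" using assms(3) by simp
  define E where "E = B * (2 * real n + 1)"
  define P where "P j w = norm w ^ (2 * j) * exp (- (B / 2) * (norm w)\<^sup>2)" for j and w :: "real \<times> real"
  have [measurable]: "P j \<in> borel_measurable borel" and P: "P j w \<ge> 0" for j w
    unfolding P_def by auto
  define M where "M j = pi * fact j / (B / 2) ^ Suc j" for j
  have intP: "(\<integral>\<^sup>+w. ennreal (P j w) \<partial>lborel) = ennreal (M j)" and M: "M j \<ge> 0" for j
    unfolding P_def M_def using nn_integral_radial_gaussian[of "B / 2" j] assms(1)
    by (simp_all del: power_Suc)
  have lin: "ennreal \<alpha> * ennreal p + ennreal \<beta> * ennreal q = ennreal (\<alpha> * p + \<beta> * q)"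
    if "\<alpha> \<ge> 0" "\<beta> \<ge> 0" "p \<ge> 0" "q \<ge> 0" for \<alpha> \<beta> p q :: real
    using that by (simp add: ennreal_mult ennreal_plus)
  \<comment> \<open>At \<open>w = z - a\<close>, \<open>f\<close> is the energy density of the
    translate by \<open>a\<close>, and \<open>g\<close> is \<open>E\<close> times its squared
    modulus.\<close>
  define f where "f w = ennreal (2 * (real n)\<^sup>2) * ennreal (P (n - 1) w) + ennreal (B\<^sup>2 / 2) * ennreal (P (Suc n) w)" for w
  define g where "g w = ennreal E * ennreal (P n w)" for w
  define S where "S = {a. (\<integral>\<^sup>+z\<in>\<Omega>. f (z - a) \<partial>lborel) \<le> (\<integral>\<^sup>+z\<in>\<Omega>. g (z - a) \<partial>lborel)}"
  define F where "F = (\<lambda>a. restrict_fun \<Omega> (landau_state B n a)) ` S"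
  have E: "E > 0" using assms(1) by (simp add: E_def)
  \<comment> \<open>Energy balance on the whole plane. As
    \<open>M (Suc j) = 2 * (j + 1) / B * M j\<close>, the two terms on the left are
    \<open>B * n * M n\<close> and \<open>B * (n + 1) * M n\<close>.\<close>
  have moments: "2 * (real n)\<^sup>2 * M (n - 1) + B\<^sup>2 / 2 * M (Suc n) = E * M n"
    using assms(1) unfolding E_def M_def
    by (cases n) (simp_all add: field_simps power2_eq_square)
  have "infinite S"
    unfolding S_def
  proof (rule infinite_translates_le)
    have "(\<integral>\<^sup>+w. f w \<partial>lborel) = ennreal (2 * (real n)\<^sup>2) * ennreal (M (n - 1)) + ennreal (B\<^sup>2 / 2) * ennreal (M (Suc n))"
      unfolding f_def by (simp add: nn_integral_add nn_integral_cmult intP)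
    also have "\<dots> = ennreal (2 * (real n)\<^sup>2 * M (n - 1) + B\<^sup>2 / 2 * M (Suc n))"
      by (rule lin) (simp_all add: M)
    also have "\<dots> = (\<integral>\<^sup>+w. g w \<partial>lborel)"
      unfolding g_def moments using E M by (simp add: nn_integral_cmult intP ennreal_mult)
    finally show "(\<integral>\<^sup>+w. f w \<partial>lborel) = (\<integral>\<^sup>+w. g w \<partial>lborel)" .
    show "(\<integral>\<^sup>+w. g w \<partial>lborel) < \<infinity>"
      unfolding g_def by (simp add: nn_integral_cmult intP ennreal_mult_less_top)
    show "emeasure lborel \<Omega> < \<infinity>"
      using assms(6) by simp
  qed (simp_all add: f_def g_def)
  then have "infinite F"
    using inj_restrict_landau_state[OF assms(3,5)] assms(1) inj_on_subset finite_imageD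
    unfolding F_def by (metis less_irrefl subset_UNIV)
  moreover have "cfun.independent F"
    unfolding F_def using independent_restrict_landau_states[OF assms(3,5)] assms(1) by simp
  moreover have "F \<subseteq> C_infinity \<Omega> \<inter> L2 \<Omega>"
    unfolding F_def
    using restrict_landau_state_C_infinity[OF assms(3)] restrict_landau_state_L2[OF assms(3,1)] by auto
  moreover have "(\<forall>z\<in>\<Omega>. mag_op B U z = of_real (B * (2 * real k - 1)) * U z) \<and>
       (\<integral>\<^sup>+z\<in>\<Omega>. ennreal ((norm (mag_grad B U z))\<^sup>2) \<partial>lebesgue)
         \<le> ennreal (B * (2 * real k - 1)) * (\<integral>\<^sup>+z\<in>\<Omega>. ennreal ((norm (U z))\<^sup>2) \<partial>lebesgue)" if "U \<in> F" for U
  proof -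
    from that obtain a where a: "a \<in> S" "U = restrict_fun \<Omega> (landau_state B n a)"
      unfolding F_def by blast
    have U: "U z = landau_state B n a z" if "z \<in> \<Omega>" for z
      using a(2) that by (simp add: restrict_fun_def)
    have "ennreal ((norm (mag_grad B U z))\<^sup>2) = f (z - a)" if "z \<in> \<Omega>" for z
    proof -
      have "(norm (mag_grad B U z))\<^sup>2 = 2 * (real n)\<^sup>2 * P (n - 1) (z - a) + B\<^sup>2 / 2 * P (Suc n) (z - a)"
        using norm_mag_grad_landau_state[OF assms(3), of U B n a z] U that
        by (simp only: norm_landau_state P_def)
      then show ?thesis
        unfolding f_def by (subst lin) (simp_all add: P)
    qed
    \<comment> \<open>\<open>lebesgue\<close> is the completion of \<open>lborel\<close>, so the
      integrals coincide, and membership of \<open>a\<close> in \<open>S\<close> is exactly the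
      required inequality.\<close>
    then have "(\<integral>\<^sup>+z\<in>\<Omega>. ennreal ((norm (mag_grad B U z))\<^sup>2) \<partial>lebesgue) = (\<integral>\<^sup>+z\<in>\<Omega>. f (z - a) \<partial>lborel)"
      unfolding nn_integral_completion by (intro nn_integral_cong) (simp split: split_indicator)
    also have "\<dots> \<le> (\<integral>\<^sup>+z\<in>\<Omega>. g (z - a) \<partial>lborel)"
      using a(1) by (simp add: S_def)
    also have "\<dots> = ennreal E * (\<integral>\<^sup>+z\<in>\<Omega>. ennreal (P n (z - a)) \<partial>lborel)"
      by (simp add: g_def mult.assoc nn_integral_cmult)
    also have "(\<integral>\<^sup>+z\<in>\<Omega>. ennreal (P n (z - a)) \<partial>lborel) = (\<integral>\<^sup>+z\<in>\<Omega>. ennreal ((norm (U z))\<^sup>2) \<partial>lebesgue)"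
      unfolding nn_integral_completion
      by (intro nn_integral_cong) (simp add: U norm_landau_state P_def split: split_indicator)
    finally show ?thesis
      using mag_op_landau_state[OF assms(3) U] unfolding k E_def by blast
  qed
  ultimately show ?thesis by blast
qed

end
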